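(* Let $X$ and $Y$ be discrete random variables with finite entropy taking values in the same abelian group, and let $C>0$ be a constant. (1) If $$\mathbf{H}\{X+Y\}\ge \mathbf{H}\{X\}+\mathbf{H}\{Y\}-\log C,$$ then $$\mathbf{A}\{X,Y\}\le \mathbf{H}\{X\}+\mathbf{H}\{Y\}+\log C.$$ (2) If $\mathbf{A}\{X,Y\}\le \mathbf{H}\{X\}+\mathbf{H}\{Y\}+\log C$ and, in addition, $\mathbf{H}\{X,Y\}\ge \mathbf{H}\{X\}+\mathbf{H}\{Y\}-C'$ for a constant $C'$, then $$\mathbf{H}\{X+Y\}\ge \mathbf{H}\{X\}+\mathbf{H}\{Y\}-\log C-2C'.$$ (3) In particular, if $X$ and $Y$ are independent and $\mathbf{A}\{X,Y\}\le \mathbf{H}\{X\}+\mathbf{H}\{Y\}+\log C$, then $\mathbf{H}\{X+Y\}\ge \mathbf{H}\{X\}+\mathbf{H}\{Y\}-\log C$.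
   Context: $\log$ is the base-2 logarithm. $\mathbf{H}$ denotes Shannon entropy in base 2: $\mathbf{H}\{Z\}=\sum_z \mathbf{P}\{Z=z\}\log(1/\mathbf{P}\{Z=z\})$; $\mathbf{H}\{X,Y\}$ is the entropy of the pair $(X,Y)$. For discrete random variables $X,Y$ in the same abelian group (not assumed independent), the entropic additive energy is $\mathbf{A}\{X,Y\}=2\mathbf{H}\{X,Y\}-\mathbf{H}\{X+Y\}$. (Equivalently, it is $\mathbf{H}\{X_1,Y_1,X_2,Y_2\}$ where $(X_1,Y_1),(X_2,Y_2)$ are conditionally independent copies of $(X,Y)$ given $X+Y$.) *)

theory Defs
  imports "HOL-Probability.Probability"
begin

text \<open>
  Countability is required of the range of \<open>X\<close> on the whole sample space, not merely up to a null set.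
  Together with measurability into \<open>count_space UNIV\<close> this makes pairs and sums of discrete random
  variables discrete random variables again, whatever the cardinality of the codomain.
\<close>

definition discrete_rv :: "'w measure \<Rightarrow> ('w \<Rightarrow> 'a) \<Rightarrow> bool" where
  "discrete_rv M X \<longleftrightarrow> X \<in> measurable M (count_space UNIV) \<and> countable (X ` space M)"

definition point_prob :: "'w measure \<Rightarrow> ('w \<Rightarrow> 'a) \<Rightarrow> 'a \<Rightarrow> real" where
  "point_prob M Z z = measure M {w \<in> space M. Z w = z}"

text \<open>
  Terms with \<open>point_prob M Z z = 0\<close> contribute \<open>0\<close>, the usual convention. All terms are non-negative, so
  summability is the same as finiteness of the sum in \<open>[0, \<infinity>]\<close>; \<open>shannon_entropy\<close> is the
  entropy only when \<open>has_finite_entropy\<close> holds. Finite entropy of \<open>X\<close> and \<open>Y\<close> implies finite entropy of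
  their pair and of their sum.
\<close>

definition has_finite_entropy :: "'w measure \<Rightarrow> ('w \<Rightarrow> 'a) \<Rightarrow> bool" where
  "has_finite_entropy M Z \<longleftrightarrow> (\<lambda>z. point_prob M Z z * log 2 (1 / point_prob M Z z)) summable_on UNIV"

definition shannon_entropy :: "'w measure \<Rightarrow> ('w \<Rightarrow> 'a) \<Rightarrow> real" where
  "shannon_entropy M Z = (\<Sum>\<^sub>\<infinity>z. point_prob M Z z * log 2 (1 / point_prob M Z z))"

definition additive_energy :: "'w measure \<Rightarrow> ('w \<Rightarrow> 'g::ab_group_add) \<Rightarrow> ('w \<Rightarrow> 'g) \<Rightarrow> real" where
  "additive_energy M X Y =
     2 * shannon_entropy M (\<lambda>w. (X w, Y w)) - shannon_entropy M (\<lambda>w. X w + Y w)"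

text \<open>Agreement with the library's measure-theoretic entropy.\<close>

lemma shannon_entropy_eq_entropy:
  assumes "prob_space M" and X: "discrete_rv M X" and fin: "has_finite_entropy M X"
  shows "shannon_entropy M X = prob_space.entropy M 2 (count_space (X ` space M)) X"
proof -
  interpret information_space M 2
    using assms(1) by (simp add: information_space_def information_space_axioms_def)
  let ?B = "X ` space M" and ?p = "point_prob M X"
  have cB: "countable ?B" and mX: "X \<in> measurable M (count_space UNIV)"
    using X by (auto simp: discrete_rv_def)
  have mB: "X \<in> measurable M (count_space ?B)"
  proof (rule measurableI)
    fix A assume "A \<in> sets (count_space ?B)"
    show "X -` A \<inter> space M \<in> sets M"
      using measurable_sets[OF mX, of A] by simp
  qed auto
  interpret S: sigma_finite_measure "count_space ?B"
    using cB by (rule sigma_finite_measure_count_space_countable)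
  have em: "emeasure (distr M (count_space ?B) X) {z} = ennreal (?p z)" if "z \<in> ?B" for z
    using that mB by (auto simp: emeasure_distr point_prob_def emeasure_eq_measure
        intro!: arg_cong[where f = prob])
  have "distr M (count_space ?B) X = density (count_space ?B) (\<lambda>z. ennreal (?p z))"
    by (rule measure_eqI_countable[where A = ?B])
       (auto simp: cB emeasure_density em[simplified])
  then have "distributed M (count_space ?B) X ?p"
    using mB by (auto simp: distributed_def)
  then have e: "entropy 2 (count_space ?B) X = - (\<integral>z. ?p z * log 2 (?p z) \<partial>count_space ?B)"
    by (intro entropy_distr) (auto simp: point_prob_def)
  have z: "?p z = 0" if "z \<notin> ?B" for z
  proof -
    have "{w \<in> space M. X w = z} = {}" using that by auto
    then show ?thesis unfolding point_prob_def by (simp only: measure_empty)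
  qed
  have sB: "(\<lambda>z. ?p z * log 2 (1 / ?p z)) summable_on ?B"
    using fin unfolding has_finite_entropy_def by (rule summable_on_subset_banach) auto
  have "shannon_entropy M X = (\<Sum>\<^sub>\<infinity>z\<in>?B. ?p z * log 2 (1 / ?p z))"
    unfolding shannon_entropy_def by (rule infsum_cong_neutral) (auto simp: z)
  also have "\<dots> = (\<Sum>\<^sub>az\<in>?B. ?p z * log 2 (1 / ?p z))"
    using iffD1[OF abs_summable_equivalent iffD1[OF summable_on_iff_abs_summable_on_real sB]]
    by (rule infsetsum_infsum[symmetric])
  also have "\<dots> = - (\<integral>z. ?p z * log 2 (?p z) \<partial>count_space ?B)"
    unfolding infsetsum_def
    by (simp add: log_recip flip: Bochner_Integration.integral_minus)
  finally show ?thesis using e by simp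
qed

end

theory Submission
  imports Defs
begin

text \<open>
  By definition the additive energy is \<open>2 H(X,Y) - H(X+Y)\<close>, so each part is a linear
  consequence of one comparison between \<open>H(X,Y)\<close> and \<open>H(X) + H(Y)\<close>: the first part needs
  subadditivity \<open>H(X,Y) \<le> H(X) + H(Y)\<close>, the second takes an approximate converse as its hypothesis,
  and independence provides the exact converse, the case \<open>C' = 0\<close>.

  Both comparisons rest on disintegrating sums over pairs. Summing the joint law \<open>p(x,y)\<close> over one
  coordinate gives the marginal of the other, so \<open>\<Sum> p(x,y) log (1 / p\<^sub>X(x)) = H(X)\<close> and likewise for
  \<open>Y\<close> (\<open>has_sum_joint_weight_fst\<close>, \<open>has_sum_joint_weight_snd\<close>). For independent variables the terms
  of \<open>H(X,Y)\<close> split exactly into these two contributions. In general they are bounded by them up to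
  the error \<open>(p\<^sub>X(x) p\<^sub>Y(y) - p(x,y)) / ln 2\<close> (\<open>gibbs_pointwise\<close>), whose total is \<open>0\<close> because both the
  product law and the joint law have mass \<open>1\<close>.
\<close>

section \<open>Marginals of a joint law\<close>

text \<open>
  Countable additivity over the fibres of \<open>Y\<close>. Only countably many fibres are non-empty, so the
  unordered sum can be taken over the whole, possibly uncountable, codomain.
\<close>

lemma (in finite_measure) has_sum_measure_fibres:
  assumes Y: "discrete_rv M Y" and A: "A \<in> sets M"
  shows "((\<lambda>y. measure M {w \<in> A. Y w = y}) has_sum measure M A) UNIV"
proof -
  let ?I = "Y ` space M"
  let ?F = "\<lambda>y. {w \<in> A. Y w = y}"
  have cI: "countable ?I" and mY: "Y \<in> measurable M (count_space UNIV)"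
    using Y by (auto simp: discrete_rv_def)
  have AM: "A \<subseteq> space M" using A by (rule sets.sets_into_space)
  have sF: "?F y \<in> sets M" for y
  proof -
    have "A \<inter> (Y -` {y} \<inter> space M) \<in> sets M"
      using A measurable_sets[OF mY, of "{y}"] by auto
    also have "A \<inter> (Y -` {y} \<inter> space M) = ?F y" using AM by auto
    finally show ?thesis .
  qed
  have U: "(\<Union>y\<in>?I. ?F y) = A" using AM by auto
  have "emeasure M (\<Union>y\<in>?I. ?F y) = (\<integral>\<^sup>+y. emeasure M (?F y) \<partial>count_space ?I)"
    by (rule emeasure_UN_countable) (use sF cI in \<open>auto simp: disjoint_family_on_def\<close>)
  then have nn: "(\<integral>\<^sup>+y. ennreal (measure M (?F y)) \<partial>count_space ?I) = ennreal (measure M A)"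
    unfolding U by (simp add: emeasure_eq_measure)
  have int: "integrable (count_space ?I) (\<lambda>y. measure M (?F y))"
    by (rule integrableI_nonneg) (auto simp: nn)
  then have abs: "Infinite_Set_Sum.abs_summable_on (\<lambda>y. measure M (?F y)) ?I"
    by (simp add: Infinite_Set_Sum.abs_summable_on_def)
  have "infsetsum (\<lambda>y. measure M (?F y)) ?I = measure M A"
    unfolding infsetsum_def by (subst integral_eq_nn_integral) (auto simp: nn)
  then have "infsum (\<lambda>y. measure M (?F y)) ?I = measure M A"
    using infsetsum_infsum[OF abs] by simp
  moreover have "(\<lambda>y. measure M (?F y)) summable_on ?I"
    by (rule iffD2[OF summable_on_iff_abs_summable_on_real iffD2[OF abs_summable_equivalent abs]])
  ultimately have "((\<lambda>y. measure M (?F y)) has_sum measure M A) ?I"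
    by (metis has_sum_infsum)
  moreover have "measure M (?F y) = 0" if "y \<notin> ?I" for y
  proof -
    have "?F y = {}" using that AM by auto
    then show ?thesis by (simp only: measure_empty)
  qed
  ultimately show ?thesis
    by (subst has_sum_cong_neutral[where T = ?I and g = "\<lambda>y. measure M (?F y)"]) auto
qed

lemma point_prob_nonneg: "point_prob M Z z \<ge> 0"
  by (simp add: point_prob_def)

lemma (in prob_space) point_prob_le_1: "point_prob M Z z \<le> 1"
  by (simp add: point_prob_def)

lemma point_prob_swap:
  "point_prob M (\<lambda>w. (Y w, X w)) (y, x) = point_prob M (\<lambda>w. (X w, Y w)) (x, y)"
  by (auto simp: point_prob_def conj_commute)

lemma discrete_rv_fibre_sets:
  assumes "discrete_rv M X"
  shows "{w \<in> space M. X w = x} \<in> sets M"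
proof -
  have "X -` {x} \<inter> space M \<in> sets M"
    using assms measurable_sets[of X M "count_space UNIV" "{x}"] by (auto simp: discrete_rv_def)
  also have "X -` {x} \<inter> space M = {w \<in> space M. X w = x}" by auto
  finally show ?thesis .
qed

lemma (in prob_space) has_sum_point_prob:
  assumes "discrete_rv M X"
  shows "(point_prob M X has_sum 1) UNIV"
  using has_sum_measure_fibres[OF assms sets.top]
  by (simp add: prob_space point_prob_def[abs_def])

lemma (in prob_space) has_sum_point_prob_pair:
  assumes X: "discrete_rv M X" and Y: "discrete_rv M Y"
  shows "((\<lambda>y. point_prob M (\<lambda>w. (X w, Y w)) (x, y)) has_sum point_prob M X x) UNIV"
  using has_sum_measure_fibres[OF Y discrete_rv_fibre_sets[OF X, of x]]
  by (simp add: point_prob_def conj_ac)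

lemma (in prob_space) point_prob_pair_le:
  assumes X: "discrete_rv M X"
  shows "point_prob M (\<lambda>w. (X w, Y w)) (x, y) \<le> point_prob M X x"
  unfolding point_prob_def
  by (rule finite_measure_mono) (use discrete_rv_fibre_sets[OF X] in auto)

text \<open>
  The expectation of \<open>g(X)\<close> can be computed under the joint law. Non-negativity of \<open>g\<close> is what allows the
  iterated sum to be read as a sum over pairs.
\<close>

lemma (in prob_space) has_sum_joint_weight_fst:
  assumes X: "discrete_rv M X" and Y: "discrete_rv M Y"
    and g: "\<And>x. g x \<ge> 0"
    and S: "((\<lambda>x. point_prob M X x * g x) has_sum S) UNIV"
  shows "((\<lambda>(x, y). point_prob M (\<lambda>w. (X w, Y w)) (x, y) * g x) has_sum S) UNIV"
proof -
  let ?f = "\<lambda>(x, y). point_prob M (\<lambda>w. (X w, Y w)) (x, y) * g x"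
  have inner: "((\<lambda>y. ?f (x, y)) has_sum point_prob M X x * g x) UNIV" for x
    using has_sum_cmult_left[OF has_sum_point_prob_pair[OF X Y, of x], of "g x"] by simp
  have "?f summable_on Sigma UNIV (\<lambda>_. UNIV)"
    by (rule summable_on_SigmaI[OF inner])
       (use S g in \<open>auto simp: summable_on_def point_prob_nonneg\<close>)
  then have "(?f has_sum S) (Sigma UNIV (\<lambda>_. UNIV))"
    by (intro has_sum_SigmaI[OF inner S])
  then show ?thesis by simp
qed

lemma (in prob_space) has_sum_joint_weight_snd:
  assumes X: "discrete_rv M X" and Y: "discrete_rv M Y"
    and g: "\<And>y. g y \<ge> 0"
    and S: "((\<lambda>y. point_prob M Y y * g y) has_sum S) UNIV"
  shows "((\<lambda>(x, y). point_prob M (\<lambda>w. (X w, Y w)) (x, y) * g y) has_sum S) UNIV"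
proof -
  have "((\<lambda>(y, x). point_prob M (\<lambda>w. (Y w, X w)) (y, x) * g y) has_sum S) (UNIV \<times> UNIV)"
    using has_sum_joint_weight_fst[OF Y X g S] by simp
  then have "((\<lambda>(x, y). point_prob M (\<lambda>w. (Y w, X w)) (y, x) * g y) has_sum S) (UNIV \<times> UNIV)"
    by (subst (asm) has_sum_swap) (simp add: case_prod_unfold)
  then show ?thesis by (simp add: point_prob_swap[of M Y X])
qed

lemma (in prob_space) has_sum_joint_point_prob:
  assumes X: "discrete_rv M X" and Y: "discrete_rv M Y"
  shows "((\<lambda>(x, y). point_prob M (\<lambda>w. (X w, Y w)) (x, y)) has_sum 1) UNIV"
  using has_sum_joint_weight_fst[OF X Y, of "\<lambda>_. 1"] has_sum_point_prob[OF X] by simp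

lemma (in prob_space) has_sum_product_point_prob:
  assumes X: "discrete_rv M X" and Y: "discrete_rv M Y"
  shows "((\<lambda>(x, y). point_prob M X x * point_prob M Y y) has_sum 1) UNIV"
proof -
  let ?f = "\<lambda>(x, y). point_prob M X x * point_prob M Y y"
  have inner: "((\<lambda>y. ?f (x, y)) has_sum point_prob M X x) UNIV" for x
    using has_sum_cmult_right[OF has_sum_point_prob[OF Y], of "point_prob M X x"] by simp
  have "?f summable_on Sigma UNIV (\<lambda>_. UNIV)"
    by (rule summable_on_SigmaI[OF inner])
       (use has_sum_point_prob[OF X] in \<open>auto simp: summable_on_def point_prob_nonneg\<close>)
  then have "(?f has_sum 1) (Sigma UNIV (\<lambda>_. UNIV))"
    by (intro has_sum_SigmaI[OF inner has_sum_point_prob[OF X]])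
  then show ?thesis by simp
qed

lemma (in prob_space) log_inverse_point_prob_nonneg: "log 2 (1 / point_prob M Z z) \<ge> 0"
proof (cases "point_prob M Z z = 0")
  case False
  then have "0 < point_prob M Z z" using point_prob_nonneg[of M Z z] by linarith
  then show ?thesis using point_prob_le_1[of Z z] by (simp add: log_recip)
next
  case True
  (* Here 1 / 0 = 0 and ln 0 = 0, so the logarithm is 0. *)
  then show ?thesis by (simp add: log_def)
qed

lemma has_sum_shannon_entropy:
  assumes "has_finite_entropy M Z"
  shows "((\<lambda>z. point_prob M Z z * log 2 (1 / point_prob M Z z)) has_sum shannon_entropy M Z) UNIV"
  using assms unfolding has_finite_entropy_def shannon_entropy_def by (rule has_sum_infsum)

section \<open>Subadditivity of entropy\<close>

text \<open>
  Written as a single sum over pairs, \<open>H(X) + H(Y)\<close> can be compared with \<open>H(X,Y)\<close> term by term.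
\<close>

lemma (in prob_space) has_sum_marginal_entropies:
  assumes X: "discrete_rv M X" and Y: "discrete_rv M Y"
    and hX: "has_finite_entropy M X" and hY: "has_finite_entropy M Y"
  shows "((\<lambda>(x, y). point_prob M (\<lambda>w. (X w, Y w)) (x, y) *
             (log 2 (1 / point_prob M X x) + log 2 (1 / point_prob M Y y)))
          has_sum shannon_entropy M X + shannon_entropy M Y) UNIV"
  using has_sum_add[OF
      has_sum_joint_weight_fst[OF X Y log_inverse_point_prob_nonneg has_sum_shannon_entropy[OF hX]]
      has_sum_joint_weight_snd[OF X Y log_inverse_point_prob_nonneg has_sum_shannon_entropy[OF hY]]]
  by (simp add: case_prod_unfold distrib_left)

text \<open>
  This is \<open>ln t \<le> t - 1\<close> at \<open>t = a b / p\<close>. The hypotheses \<open>p \<le> a\<close> and \<open>p \<le> b\<close> make \<open>t\<close> positive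
  whenever \<open>p\<close> is.
\<close>

lemma gibbs_pointwise:
  fixes p a b :: real
  assumes "0 \<le> p" "p \<le> a" "p \<le> b"
  shows "p * log 2 (1 / p) \<le> p * (log 2 (1 / a) + log 2 (1 / b)) + (a * b - p) / ln 2"
proof (cases "p = 0")
  case True
  then show ?thesis using assms by simp
next
  case False
  then have pos: "p > 0" "a > 0" "b > 0" using assms by auto
  have "p * ln (a * b / p) \<le> p * (a * b / p - 1)"
    using pos by (intro mult_left_mono ln_le_minus_one) auto
  also have "\<dots> = a * b - p" using pos by (simp add: field_simps)
  finally have "p * ln (a * b / p) / ln 2 \<le> (a * b - p) / ln 2"
    by (intro divide_right_mono) auto
  moreover have "p * log 2 (1 / p) - p * (log 2 (1 / a) + log 2 (1 / b)) = p * ln (a * b / p) / ln 2"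
  proof -
    have L: "ln (a * b / p) = ln a + ln b - ln p" using pos by (simp add: ln_div ln_mult)
    show ?thesis
      unfolding L log_recip
      by (simp add: log_def algebra_simps diff_divide_distrib add_divide_distrib)
  qed
  ultimately show ?thesis by linarith
qed

text \<open>
  The pointwise majorant sums to \<open>H(X) + H(Y)\<close>, since its correction terms cancel in total. The
  joint entropy is therefore finite by comparison before its value is bounded.
\<close>

lemma (in prob_space) shannon_entropy_pair_le:
  assumes X: "discrete_rv M X" and Y: "discrete_rv M Y"
    and hX: "has_finite_entropy M X" and hY: "has_finite_entropy M Y"
  shows "shannon_entropy M (\<lambda>w. (X w, Y w)) \<le> shannon_entropy M X + shannon_entropy M Y"
proof -
  define p where "p = point_prob M (\<lambda>w. (X w, Y w))"
  define m where "m = (\<lambda>(x, y). p (x, y) * (log 2 (1 / point_prob M X x) + log 2 (1 / point_prob M Y y))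
      + (point_prob M X x * point_prob M Y y - p (x, y)) / ln 2)"
  have err: "((\<lambda>(x, y). (point_prob M X x * point_prob M Y y - p (x, y)) / ln 2) has_sum 0) UNIV"
  proof -
    have "((\<lambda>z. - (case z of (x, y) \<Rightarrow> p (x, y))) has_sum - 1) UNIV"
      using has_sum_joint_point_prob[OF X Y] by (subst has_sum_uminus) (simp add: p_def)
    from has_sum_cmult_left[OF has_sum_add[OF has_sum_product_point_prob[OF X Y] this], of "1 / ln 2"]
    show ?thesis by (simp add: case_prod_unfold)
  qed
  have m: "(m has_sum shannon_entropy M X + shannon_entropy M Y) UNIV"
    using has_sum_add[OF has_sum_marginal_entropies[OF X Y hX hY] err]
    by (simp add: case_prod_unfold p_def m_def)
  have le: "p z * log 2 (1 / p z) \<le> m z" for z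
  proof (cases z)
    case (Pair x y)
    have "p (x, y) \<le> point_prob M X x" "p (x, y) \<le> point_prob M Y y"
      using point_prob_pair_le[OF X, of Y x y] point_prob_pair_le[OF Y, of X y x]
      by (simp_all add: p_def point_prob_swap[of M Y X])
    then show ?thesis
      using gibbs_pointwise[of "p (x, y)" "point_prob M X x" "point_prob M Y y"]
      by (simp add: Pair m_def p_def point_prob_nonneg)
  qed
  have "(\<lambda>z. p z * log 2 (1 / p z)) summable_on UNIV"
  proof (rule summable_on_comparison_test)
    show "m summable_on UNIV" using m by (auto simp: summable_on_def)
    show "0 \<le> p z * log 2 (1 / p z)" for z
      unfolding p_def by (intro mult_nonneg_nonneg point_prob_nonneg log_inverse_point_prob_nonneg)
  qed (rule le)
  then have "has_finite_entropy M (\<lambda>w. (X w, Y w))"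
    by (simp add: has_finite_entropy_def p_def)
  from has_sum_mono[OF has_sum_shannon_entropy[OF this] m] le show ?thesis
    by (simp add: p_def)
qed

section \<open>Independent variables\<close>

lemma (in prob_space) point_prob_pair_indep:
  assumes "indep_var (count_space UNIV) X (count_space UNIV) Y"
  shows "point_prob M (\<lambda>w. (X w, Y w)) (x, y) = point_prob M X x * point_prob M Y y"
  using indep_varD[OF assms, of "{x}" "{y}"]
  by (simp add: point_prob_def vimage_def Int_def conj_ac)

text \<open>
  For independent variables \<open>log (1 / p(x,y))\<close> is the sum of the marginal logarithms wherever the
  joint law does not vanish; elsewhere both terms carry the weight \<open>0\<close>.
\<close>

lemma (in prob_space) shannon_entropy_pair_indep:
  assumes X: "discrete_rv M X" and Y: "discrete_rv M Y"
    and hX: "has_finite_entropy M X" and hY: "has_finite_entropy M Y"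
    and ind: "indep_var (count_space UNIV) X (count_space UNIV) Y"
  shows "shannon_entropy M (\<lambda>w. (X w, Y w)) = shannon_entropy M X + shannon_entropy M Y"
proof -
  let ?p = "point_prob M (\<lambda>w. (X w, Y w))"
  have split: "?p z * log 2 (1 / ?p z) =
      (case z of (x, y) \<Rightarrow> ?p (x, y) * (log 2 (1 / point_prob M X x) + log 2 (1 / point_prob M Y y)))" for z
  proof (cases z)
    case (Pair x y)
    show ?thesis
    proof (cases "?p (x, y) = 0")
      case False
      then have "point_prob M X x > 0" "point_prob M Y y > 0"
        using point_prob_nonneg[of M X x] point_prob_nonneg[of M Y y]
        by (auto simp: point_prob_pair_indep[OF ind] less_le)
      then show ?thesis
        by (simp add: Pair point_prob_pair_indep[OF ind] log_mult log_recip)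
    qed (simp add: Pair)
  qed
  show ?thesis
    unfolding shannon_entropy_def[of M "\<lambda>w. (X w, Y w)"] split
    by (rule infsumI[OF has_sum_marginal_entropies[OF X Y hX hY]])
qed

section \<open>Entropic additive energy\<close>

theorem proposition10:
  fixes M :: "'w measure"
    and X Y :: "'w \<Rightarrow> 'g::ab_group_add"
    and C :: real
  assumes "prob_space M"
    and "discrete_rv M X" and "discrete_rv M Y"
    and "has_finite_entropy M X" and "has_finite_entropy M Y"
    and "C > 0"
  shows
    "(shannon_entropy M (\<lambda>w. X w + Y w) \<ge> shannon_entropy M X + shannon_entropy M Y - log 2 C
        \<longrightarrow> additive_energy M X Y \<le> shannon_entropy M X + shannon_entropy M Y + log 2 C)
     \<and>
     (\<forall>C' :: real.
        additive_energy M X Y \<le> shannon_entropy M X + shannon_entropy M Y + log 2 C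
        \<and> shannon_entropy M (\<lambda>w. (X w, Y w)) \<ge> shannon_entropy M X + shannon_entropy M Y - C'
        \<longrightarrow> shannon_entropy M (\<lambda>w. X w + Y w)
              \<ge> shannon_entropy M X + shannon_entropy M Y - log 2 C - 2 * C')
     \<and>
     (prob_space.indep_var M (count_space UNIV) X (count_space UNIV) Y
        \<and> additive_energy M X Y \<le> shannon_entropy M X + shannon_entropy M Y + log 2 C
        \<longrightarrow> shannon_entropy M (\<lambda>w. X w + Y w)
              \<ge> shannon_entropy M X + shannon_entropy M Y - log 2 C)"
proof -
  interpret prob_space M by fact
  note joint_le = shannon_entropy_pair_le[OF assms(2-5)]
  note joint_eq = shannon_entropy_pair_indep[OF assms(2-5)]
  show ?thesis
    using joint_le joint_eq by (auto simp: additive_energy_def)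
qed

end
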